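(* Let $\mathbf{L}$ be a De Morgan semi-Heyting algebra of level $1$. Then $\mathbf{L}$ satisfies the Stone identity $x^*\vee x^{**}\approx 1$.
   Context: A semi-Heyting algebra is an algebra $\langle L,\vee,\wedge,\to,0,1\rangle$ such that $\langle L,\vee,\wedge,0,1\rangle$ is a bounded lattice and the identities $x\wedge(x\to y)\approx x\wedge y$, $x\wedge(y\to z)\approx x\wedge[(x\wedge y)\to(x\wedge z)]$, and $x\to x\approx 1$ hold; $x^* := x\to 0$ is the pseudocomplement. A dually quasi-De Morgan semi-Heyting algebra ($\mathbf{DQD}$-algebra) is an algebra $\langle L,\vee,\wedge,\to,{}',0,1\rangle$ whose reduct $\langle L,\vee,\wedge,\to,0,1\rangle$ is a semi-Heyting algebra and which satisfies $0'\approx 1$, $1'\approx 0$, $(x\wedge y)'\approx x'\vee y'$, $(x\vee y)''\approx x''\vee y''$, and $x''\le x$. A De Morgan semi-Heyting algebra is a $\mathbf{DQD}$-algebra satisfying $x''\approx x$. Define $x^{0('^* )} := x$, $x^{(k+1)('^* )} := ((x^{k('^* )})')^*$, $t_0(x):=x$, $t_{k+1}(x):=t_k(x)\wedge x^{(k+1)('^* )}$. The algebra is of level $1$ if it satisfies $t_1(x)\approx t_2(x)$. *)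

theory Defs
  imports Main
begin

unbundle lattice_syntax

text \<open>
  An algebra is a type with its operations; the lattice constants 0 and 1 of the
  literature are \<open>\<bottom>\<close> and \<open>\<top>\<close>, and the one-element algebra (\<open>\<bottom> = \<top>\<close>) is not excluded.
\<close>

class semi_heyting_algebra = bounded_lattice +
  fixes shimp :: "'a \<Rightarrow> 'a \<Rightarrow> 'a"  (infixr "\<leadsto>" 55)
  assumes inf_shimp: "x \<sqinter> (x \<leadsto> y) = x \<sqinter> y"
    and inf_shimp_inf: "x \<sqinter> (y \<leadsto> z) = x \<sqinter> ((x \<sqinter> y) \<leadsto> (x \<sqinter> z))"
    and shimp_refl: "x \<leadsto> x = \<top>"
begin

definition pcompl :: "'a \<Rightarrow> 'a"
  where "pcompl x = x \<leadsto> \<bottom>"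

end

class dqd_algebra = semi_heyting_algebra +
  fixes dneg :: "'a \<Rightarrow> 'a"  \<comment> \<open>the operation written \<open>x'\<close>\<close>
  assumes dneg_bot: "dneg \<bottom> = \<top>"
    and dneg_top: "dneg \<top> = \<bottom>"
    and dneg_inf: "dneg (x \<sqinter> y) = dneg x \<squnion> dneg y"
    and dneg_dneg_sup: "dneg (dneg (x \<squnion> y)) = dneg (dneg x) \<squnion> dneg (dneg y)"
    and dneg_dneg_le: "dneg (dneg x) \<le> x"
begin

text \<open>\<open>iter_dp k x\<close> is $x^{k({}'{}^*)}$: the dual negation is applied first, then the pseudocomplement.\<close>

primrec iter_dp :: "nat \<Rightarrow> 'a \<Rightarrow> 'a" where
  "iter_dp 0 x = x"
| "iter_dp (Suc k) x = pcompl (dneg (iter_dp k x))"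

primrec level_term :: "nat \<Rightarrow> 'a \<Rightarrow> 'a" where
  "level_term 0 x = x"
| "level_term (Suc k) x = level_term k x \<sqinter> iter_dp (Suc k) x"

end

class de_morgan_semi_heyting_algebra = dqd_algebra +
  assumes dneg_dneg: "dneg (dneg x) = x"

end

theory Submission
  imports Defs
begin

text \<open>
  Level 1, evaluated at \<open>dneg a\<close>, says that \<open>t = dneg a \<sqinter> pcompl a\<close> is disjoint from \<open>dneg t\<close>;
  in particular \<open>dneg a \<sqinter> pcompl a \<sqinter> dneg (pcompl a) = \<bottom>\<close> for every \<open>a\<close>. Take \<open>b = pcompl x\<close> and
  \<open>c = pcompl b\<close>, which are pseudocomplements of each other. Then \<open>dneg b \<sqinter> dneg c\<close> is disjoint
  from both \<open>b\<close> and \<open>c\<close>, so it lies below both \<open>c\<close> and \<open>b\<close> and is therefore \<open>\<bottom>\<close>. Applying \<open>dneg\<close>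
  yields \<open>b \<squnion> c = \<top>\<close>.
\<close>

context semi_heyting_algebra
begin

lemma le_pcompl_iff: "x \<le> pcompl y \<longleftrightarrow> x \<sqinter> y = \<bottom>"
proof
  assume "x \<le> pcompl y"
  then have "x \<sqinter> y \<le> y \<sqinter> (y \<leadsto> \<bottom>)"
    by (simp add: pcompl_def le_infI1)
  then show "x \<sqinter> y = \<bottom>"
    by (simp add: inf_shimp bot_unique)
next
  assume "x \<sqinter> y = \<bottom>"
  \<comment> \<open>Relativizing to \<open>x\<close> turns \<open>y \<leadsto> \<bottom>\<close>
    into \<open>\<bottom> \<leadsto> \<bottom>\<close>, which is \<open>\<top>\<close>.\<close>
  then have "x \<sqinter> (y \<leadsto> \<bottom>) = x"
    using inf_shimp_inf[of x y \<bottom>] by (simp add: shimp_refl)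
  then show "x \<le> pcompl y"
    by (simp add: pcompl_def inf.absorb_iff1)
qed

lemma pcompl_antimono: "x \<le> y \<Longrightarrow> pcompl y \<le> pcompl x"
  by (metis le_pcompl_iff inf_mono order_refl bot_unique)

lemma le_pcompl_pcompl: "x \<le> pcompl (pcompl x)"
  by (metis le_pcompl_iff inf_commute order_refl)

lemma pcompl_pcompl_pcompl: "pcompl (pcompl (pcompl x)) = pcompl x"
  by (simp add: order.antisym le_pcompl_pcompl pcompl_antimono)

end

context de_morgan_semi_heyting_algebra
begin

text \<open>Dual of \<open>dneg_inf\<close>, via the involution.\<close>

lemma dneg_sup: "dneg (x \<squnion> y) = dneg x \<sqinter> dneg y"
  by (metis dneg_dneg dneg_inf)

lemma level_1_inf_dneg_pcompl:
  assumes "\<forall>y. level_term 1 y = level_term 2 y"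
  shows "dneg a \<sqinter> pcompl a \<sqinter> dneg (pcompl a) = \<bottom>"
proof -
  \<comment> \<open>At \<open>dneg a\<close> the first iterate is \<open>pcompl a\<close>, since the
    two \<open>dneg\<close> cancel. The right-hand side is the second iterate, which level 1 makes
    redundant in the meet.\<close>
  have "dneg a \<sqinter> pcompl a \<le> pcompl (dneg (pcompl a))"
    using assms[rule_format, of "dneg a"]
    by (simp add: numeral_2_eq_2 dneg_dneg inf.absorb_iff1)
  then show ?thesis
    by (simp add: le_pcompl_iff)
qed

end

theorem theorem3p3:
  fixes x :: "'a::de_morgan_semi_heyting_algebra"
  assumes level_1: "\<forall>y::'a. level_term 1 y = level_term 2 y"
  shows "pcompl x \<squnion> pcompl (pcompl x) = \<top>"
proof -
  define b where "b = pcompl x"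
  define c where "c = pcompl b"
  have b: "b = pcompl c"
    by (simp add: b_def c_def pcompl_pcompl_pcompl)
  have "dneg b \<sqinter> dneg c \<sqinter> c = \<bottom>"
    using level_1_inf_dneg_pcompl[OF level_1, of b] by (simp add: c_def inf_commute inf_left_commute)
  then have "dneg b \<sqinter> dneg c \<le> b"
    by (simp add: b le_pcompl_iff)
  moreover have "dneg b \<sqinter> dneg c \<sqinter> b = \<bottom>"
    using level_1_inf_dneg_pcompl[OF level_1, of c] by (simp add: b inf_commute inf_left_commute)
  \<comment> \<open>A meet below \<open>b\<close> and disjoint from \<open>b\<close> is
    \<open>\<bottom>\<close>.\<close>
  ultimately have "dneg (b \<squnion> c) = \<bottom>"
    by (simp add: dneg_sup inf.absorb1)
  then have "b \<squnion> c = \<top>"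
    by (metis dneg_dneg dneg_bot)
  then show ?thesis
    by (simp add: b_def c_def)
qed

end
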